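(* Let $B(x):=\tfrac12\mathbb{1}_{-1}(x)+\tfrac12\mathbb{1}_{1}(x)$, $x\in\mathbb{R}$, be the distribution function of the law with mass $\tfrac12$ at each of the points $\pm1$, and let $B_k(x):=B(k!\,x)$, $x\in\mathbb{R}$, $k\in\mathbb{N}$. Let $F_s:=B_1*B_2*\cdots*B_n*\cdots$ be the infinite convolution, i.e. the (continuous singular) distribution function with characteristic function $$f_s(t)=\prod_{k=1}^{\infty}\cos(t/k!),\qquad t\in\mathbb{R}.$$ Then the distribution function $$F_*(x):=\tfrac12\,\mathbb{1}_0(x)+\tfrac12\,F_s(x),\qquad x\in\mathbb{R},$$ does not belong to the class $\boldsymbol{Q}$.
   Context: For $a\in\mathbb{R}$, $\mathbb{1}_a$ is the distribution function of the degenerate law at $a$: $\mathbb{1}_a(x)=1$ for $x\geqslant a$ and $\mathbb{1}_a(x)=0$ for $x<a$. $*$ denotes convolution of distribution functions. A distribution function $F$ is infinitely divisible if for every positive integer $n$ there is a distribution function $F_{1/n}$ whose $n$-fold convolution power equals $F$. The class $\boldsymbol{Q}$ of rational-infinitely divisible distribution functions consists of all distribution functions $F$ on $\mathbb{R}$ for which there exist infinitely divisible distribution functions $F_1,F_2$ with $F_1=F*F_2$. *)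

theory Defs
  imports "HOL-Probability.Probability"
begin

definition distribution_function :: "(real \<Rightarrow> real) \<Rightarrow> bool" where
  "distribution_function F \<longleftrightarrow>
     mono F \<and> (\<forall>a. continuous (at_right a) F) \<and>
     (F \<longlongrightarrow> 0) at_bot \<and> (F \<longlongrightarrow> 1) at_top"

definition degenerate_df :: "real \<Rightarrow> real \<Rightarrow> real" where
  "degenerate_df a x = (if a \<le> x then 1 else 0)"

text \<open>For distribution functions this is the usual Stieltjes convolution, see
  \<open>df_convolution_Stieltjes\<close> below.\<close>

definition df_convolution :: "(real \<Rightarrow> real) \<Rightarrow> (real \<Rightarrow> real) \<Rightarrow> real \<Rightarrow> real" where
  "df_convolution F G = cdf (convolution (interval_measure F) (interval_measure G))"

primrec df_convolution_power :: "(real \<Rightarrow> real) \<Rightarrow> nat \<Rightarrow> real \<Rightarrow> real" where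
  "df_convolution_power F 0 = degenerate_df 0"
| "df_convolution_power F (Suc n) = df_convolution (df_convolution_power F n) F"

definition infinitely_divisible :: "(real \<Rightarrow> real) \<Rightarrow> bool" where
  "infinitely_divisible F \<longleftrightarrow>
     distribution_function F \<and>
     (\<forall>n>0. \<exists>G. distribution_function G \<and> df_convolution_power G n = F)"

definition rational_infinitely_divisible :: "(real \<Rightarrow> real) set" where
  "rational_infinitely_divisible =
     {F. distribution_function F \<and>
         (\<exists>F1 F2. infinitely_divisible F1 \<and> infinitely_divisible F2 \<and>
                  F1 = df_convolution F F2)}"

primrec df_convolution_upto :: "(nat \<Rightarrow> real \<Rightarrow> real) \<Rightarrow> nat \<Rightarrow> real \<Rightarrow> real" where
  "df_convolution_upto G 0 = degenerate_df 0"
| "df_convolution_upto G (Suc n) = df_convolution (df_convolution_upto G n) (G (Suc n))"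

text \<open>The infinite convolution of \<open>G 1, G 2, \<dots>\<close> (indices from 1) is the weak limit of the partial
  convolutions; it is an arbitrary function if there is no such limit. For the sequence used here
  the limit exists and is unique, see \<open>F_s_facts\<close>, \<open>char_F_s\<close> and \<open>F_s_unique\<close> below.\<close>

definition infinite_df_convolution :: "(nat \<Rightarrow> real \<Rightarrow> real) \<Rightarrow> real \<Rightarrow> real" where
  "infinite_df_convolution G =
     (THE F. distribution_function F \<and> weak_conv (df_convolution_upto G) F)"

definition bernoulli_df :: "real \<Rightarrow> real" where
  "bernoulli_df x = 1/2 * degenerate_df (-1) x + 1/2 * degenerate_df 1 x"

definition scaled_bernoulli_df :: "nat \<Rightarrow> real \<Rightarrow> real" where
  "scaled_bernoulli_df k x = bernoulli_df (fact k * x)"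

definition F_s :: "real \<Rightarrow> real" where
  "F_s = infinite_df_convolution scaled_bernoulli_df"

definition F_star :: "real \<Rightarrow> real" where
  "F_star x = 1/2 * degenerate_df 0 x + 1/2 * F_s x"

lemma distribution_function_cdf: "real_distribution M \<Longrightarrow> distribution_function (cdf M)"
proof -
  assume "real_distribution M"
  then interpret real_distribution M .
  show ?thesis
    unfolding distribution_function_def
    using cdf_nondecreasing cdf_is_right_cont cdf_lim_at_bot cdf_lim_at_top_prob
    by (auto intro: monoI)
qed

lemma real_distribution_interval_measure_df:
  "distribution_function F \<Longrightarrow> real_distribution (interval_measure F)"
  unfolding distribution_function_def
  by (intro real_distribution_interval_measure) (auto dest: monoD)

lemma cdf_interval_measure_df: "distribution_function F \<Longrightarrow> cdf (interval_measure F) = F"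
  unfolding distribution_function_def
  by (intro cdf_interval_measure) (auto dest: monoD)

lemma interval_measure_cdf: "real_distribution M \<Longrightarrow> interval_measure (cdf M) = M"
  by (intro cdf_unique real_distribution_interval_measure_df distribution_function_cdf
      cdf_interval_measure_df)

lemma real_distribution_convolution:
  assumes "real_distribution M" "real_distribution N"
  shows "real_distribution (convolution M N)"
proof -
  interpret M: real_distribution M by fact
  interpret N: real_distribution N by fact
  interpret pair_prob_space M N ..
  show ?thesis
    unfolding convolution_def by (rule real_distribution_distr) measurable
qed

lemma df_convolution_interval_measure:
  assumes "distribution_function F" "distribution_function G"
  shows "distribution_function (df_convolution F G)"
    and "interval_measure (df_convolution F G) =
           convolution (interval_measure F) (interval_measure G)"
  unfolding df_convolution_def
  by (intro distribution_function_cdf interval_measure_cdf real_distribution_convolution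
      real_distribution_interval_measure_df assms)+

lemma df_convolution_Stieltjes:
  assumes F: "distribution_function F" and G: "distribution_function G"
  shows "df_convolution F G x = (\<integral>y. F (x - y) \<partial>interval_measure G)"
proof -
  interpret F: real_distribution "interval_measure F"
    by (rule real_distribution_interval_measure_df[OF F])
  interpret G: real_distribution "interval_measure G"
    by (rule real_distribution_interval_measure_df[OF G])
  interpret C: real_distribution "convolution (interval_measure F) (interval_measure G)"
    by (intro real_distribution_convolution F.real_distribution_axioms G.real_distribution_axioms)
  have F_eq: "F z = measure (interval_measure F) {..z}" for z
    using cdf_interval_measure_df[OF F] by (metis cdf_def2)
  have [measurable]: "F \<in> borel_measurable borel"
    using F by (auto simp: distribution_function_def intro: borel_measurable_mono)
  have bnd: "0 \<le> F z" "F z \<le> 1" for z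
    by (simp_all add: F_eq)
  have int: "integrable (interval_measure G) (\<lambda>y. F (x - y))"
    by (rule G.integrable_const_bound[where B=1]) (auto simp: bnd)
  have *: "{a. a + y \<le> x} = {..x - y}" for y :: real
    by auto
  have "emeasure (convolution (interval_measure G) (interval_measure F)) {..x} =
      (\<integral>\<^sup>+y. emeasure (interval_measure F) {..x - y} \<partial>interval_measure G)"
    by (subst convolution_emeasure)
       (auto simp: * F.finite_measure_axioms G.finite_measure_axioms)
  also have "\<dots> = (\<integral>\<^sup>+y. ennreal (F (x - y)) \<partial>interval_measure G)"
    by (simp add: F_eq F.emeasure_eq_measure)
  also have "\<dots> = ennreal (\<integral>y. F (x - y) \<partial>interval_measure G)"
    by (rule nn_integral_eq_integral[OF int]) (simp add: bnd)
  finally have "emeasure (convolution (interval_measure F) (interval_measure G)) {..x} =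
      ennreal (\<integral>y. F (x - y) \<partial>interval_measure G)"
    by (subst convolution_commutative)
       (auto simp: F.finite_measure_axioms G.finite_measure_axioms)
  then show ?thesis
    by (simp add: df_convolution_def cdf_def2 measure_def integral_nonneg_AE bnd)
qed

lemma char_convolution:
  assumes "real_distribution M" "real_distribution N"
  shows "char (convolution M N) t = char M t * char N t"
proof -
  interpret M: real_distribution M by fact
  interpret N: real_distribution N by fact
  interpret pair_prob_space M N ..
  have int: "integrable (M \<Otimes>\<^sub>M N) (\<lambda>(x, y). iexp (t * (x + y)))"
    by (rule P.integrable_const_bound[where B=1]) auto
  have "char (convolution M N) t = (\<integral>z. (\<lambda>(x, y). iexp (t * (x + y))) z \<partial>(M \<Otimes>\<^sub>M N))"
    unfolding char_def convolution_def
    by (subst integral_distr) (auto simp: case_prod_unfold)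
  also have "\<dots> = (\<integral>x. (\<integral>y. iexp (t * (x + y)) \<partial>N) \<partial>M)"
    by (rule integral_fst[OF int, symmetric])
  also have "\<dots> = (\<integral>x. iexp (t * x) * char N t \<partial>M)"
    by (simp add: char_def exp_add distrib_left)
  also have "\<dots> = char M t * char N t"
    by (simp add: char_def)
  finally show ?thesis .
qed

lemma degenerate_df_eq_cdf: "degenerate_df a = cdf (return borel a)"
  by (auto simp: fun_eq_iff degenerate_df_def cdf_def2 measure_return split: split_indicator)

lemma degenerate_df_facts:
  "distribution_function (degenerate_df a)"
  "interval_measure (degenerate_df a) = return borel a"
proof -
  have "real_distribution (return borel a)"
    by (simp add: real_distribution_def real_distribution_axioms_def prob_space_return)
  then show "distribution_function (degenerate_df a)"
    "interval_measure (degenerate_df a) = return borel a"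
    by (simp_all add: degenerate_df_eq_cdf distribution_function_cdf interval_measure_cdf)
qed

lemma scaled_bernoulli_df_facts:
  fixes k :: nat
  defines "p \<equiv> pmf_of_set {- 1 / fact k, 1 / fact k :: real}"
  shows "distribution_function (scaled_bernoulli_df k)" (is ?A)
    and "interval_measure (scaled_bernoulli_df k) = distr (measure_pmf p) borel id" (is ?B)
    and "char (interval_measure (scaled_bernoulli_df k)) t = cos (t / fact k)" (is ?C)
proof -
  have rd: "real_distribution (distr (measure_pmf p) borel id)"
    by (rule prob_space.real_distribution_distr[OF measure_pmf.prob_space_axioms]) simp
  have ne: "- 1 / fact k \<noteq> (1 / fact k :: real)"
    by (simp add: field_simps)
  have card: "card {- 1 / fact k, 1 / fact k :: real} = 2"
    using ne by simp
  have le: "a / fact k \<le> x \<longleftrightarrow> a \<le> fact k * x" for a x :: real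
    by (simp add: field_simps)
  have eq: "scaled_bernoulli_df k = cdf (distr (measure_pmf p) borel id)"
  proof
    fix x :: real
    have "cdf (distr (measure_pmf p) borel id) x = measure (measure_pmf p) {..x}"
      by (simp add: cdf_def2 measure_distr)
    also have "\<dots> = real (card ({- 1 / fact k, 1 / fact k} \<inter> {..x})) / 2"
      unfolding p_def by (subst measure_pmf_of_set) (use card in auto)
    also have "\<dots> = scaled_bernoulli_df k x"
      using ne le[of "-1" x] le[of 1 x]
      by (auto simp: scaled_bernoulli_df_def bernoulli_df_def degenerate_df_def Int_insert_left)
    finally show "scaled_bernoulli_df k x = cdf (distr (measure_pmf p) borel id) x" by simp
  qed
  show ?A ?B
    unfolding eq using rd by (simp_all add: distribution_function_cdf interval_measure_cdf)
  have "char (distr (measure_pmf p) borel id) t = (\<integral>x. iexp (t * x) \<partial>measure_pmf p)"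
    unfolding char_def by (subst integral_distr) auto
  also have "\<dots> = (\<Sum>x\<in>{- 1 / fact k, 1 / fact k}. iexp (t * x)) / 2"
    unfolding p_def
    by (subst integral_measure_pmf[where A="{- 1 / fact k, 1 / fact k}"])
       (use card in \<open>auto simp: scaleR_conv_of_real sum_distrib_left\<close>)
  also have "\<dots> = cos (t / fact k)"
    unfolding cis_conv_exp[symmetric] using ne by (simp add: complex_eq_iff)
  finally show ?C
    using \<open>?B\<close> by simp
qed

lemma scaled_bernoulli_upto_facts:
  "distribution_function (df_convolution_upto scaled_bernoulli_df n)" (is ?A)
  "char (interval_measure (df_convolution_upto scaled_bernoulli_df n)) t =
     (\<Prod>k=1..n. cos (t / fact k))" (is ?B)
proof -
  have "?A \<and> ?B"
  proof (induction n)
    case 0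
    show ?case
      using degenerate_df_facts[of 0] by (simp add: char_def integral_return)
  next
    case (Suc n)
    then show ?case
      by (simp add: df_convolution_interval_measure scaled_bernoulli_df_facts(1,3)
          char_convolution real_distribution_interval_measure_df del: fact_Suc)
  qed
  then show ?A ?B by simp_all
qed

lemma distribution_function_weak_limit_unique:
  assumes "\<And>n. distribution_function (Fn n)" "distribution_function F" "distribution_function G"
    and "weak_conv Fn F" "weak_conv Fn G"
  shows "F = G"
proof -
  have rd: "real_distribution (interval_measure (Fn n))" "real_distribution (interval_measure F)"
    "real_distribution (interval_measure G)" for n
    using assms by (simp_all add: real_distribution_interval_measure_df)
  have wc: "weak_conv_m (\<lambda>n. interval_measure (Fn n)) (interval_measure F)"
    "weak_conv_m (\<lambda>n. interval_measure (Fn n)) (interval_measure G)"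
    using assms by (simp_all add: weak_conv_m_def cdf_interval_measure_df)
  have "char (interval_measure F) = char (interval_measure G)"
    by (rule ext, rule LIMSEQ_unique[OF levy_continuity1[OF rd(1,2) wc(1)]
          levy_continuity1[OF rd(1,3) wc(2)]])
  then have "interval_measure F = interval_measure G"
    by (rule Levy_uniqueness[OF rd(2,3)])
  then show ?thesis
    using assms cdf_interval_measure_df by metis
qed

lemma AE_convolution_abs_le:
  assumes M: "real_distribution M" and N: "real_distribution N"
    and a: "AE x in M. \<bar>x\<bar> \<le> a" and b: "AE x in N. \<bar>x\<bar> \<le> b"
  shows "AE x in convolution M N. \<bar>x\<bar> \<le> a + b"
proof -
  interpret M: real_distribution M by fact
  interpret N: real_distribution N by fact
  interpret pair_prob_space M N ..
  have [measurable_cong]: "sets M = sets borel" "sets N = sets borel"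
    by simp_all
  have "AE x in M. AE y in N. \<bar>x + y\<bar> \<le> a + b"
    using a by eventually_elim (use b in eventually_elim, linarith)
  moreover have "{z \<in> space (M \<Otimes>\<^sub>M N). \<bar>fst z + snd z\<bar> \<le> a + b} \<in> sets (M \<Otimes>\<^sub>M N)"
    by measurable
  ultimately have "AE z in M \<Otimes>\<^sub>M N. \<bar>fst z + snd z\<bar> \<le> a + b"
    by (intro AE_pair_measure) simp_all
  then show ?thesis
    unfolding convolution_def by (subst AE_distr_iff) (auto simp: case_prod_unfold)
qed

lemma scaled_bernoulli_upto_bound:
  "AE x in interval_measure (df_convolution_upto scaled_bernoulli_df n).
     \<bar>x\<bar> \<le> (\<Sum>k=1..n. 1 / fact k)"
proof (induction n)
  case 0
  show ?case
    unfolding df_convolution_upto.simps degenerate_df_facts by (subst AE_return) auto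
next
  case (Suc n)
  let ?p = "pmf_of_set {- 1 / fact (Suc n), 1 / fact (Suc n) :: real}"
  have "AE x in measure_pmf ?p. \<bar>x\<bar> \<le> 1 / fact (Suc n)"
    by (auto simp: AE_measure_pmf_iff simp del: fact_Suc)
  then have "AE x in interval_measure (scaled_bernoulli_df (Suc n)). \<bar>x\<bar> \<le> 1 / fact (Suc n)"
    unfolding scaled_bernoulli_df_facts(2) by (subst AE_distr_iff) auto
  then have "AE x in convolution (interval_measure (df_convolution_upto scaled_bernoulli_df n))
      (interval_measure (scaled_bernoulli_df (Suc n))).
      \<bar>x\<bar> \<le> (\<Sum>k=1..n. 1 / fact k) + 1 / fact (Suc n)"
    by (intro AE_convolution_abs_le Suc.IH real_distribution_interval_measure_df
        scaled_bernoulli_upto_facts(1) scaled_bernoulli_df_facts(1))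
  also have "(\<Sum>k=1..n. 1 / fact k) + 1 / fact (Suc n) = (\<Sum>k=1..Suc n. 1 / fact k :: real)"
    by simp
  finally show ?case
    unfolding df_convolution_upto.simps
      df_convolution_interval_measure(2)[OF scaled_bernoulli_upto_facts(1)
        scaled_bernoulli_df_facts(1)] .
qed

lemma cos_product_convergent: "convergent_prod (\<lambda>k. complex_of_real (cos (t / fact (Suc k))))"
proof (rule abs_convergent_prod_imp_convergent_prod[OF summable_imp_abs_convergent_prod])
  have bound: "norm (complex_of_real (cos (t / fact (Suc k))) - 1) \<le> t\<^sup>2 / 2 * (1 / fact k)"
    for k :: nat
  proof -
    define x where "x = t / fact (Suc k)"
    have "norm (complex_of_real (cos x) - 1) = \<bar>cos x - 1\<bar>"
      by (metis norm_of_real of_real_1 of_real_diff)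
    also have "\<dots> = 2 * \<bar>sin (x / 2)\<bar>\<^sup>2"
      using cos_double_sin[of "x / 2"] by simp
    also have "\<dots> \<le> 2 * \<bar>x / 2\<bar>\<^sup>2"
      by (intro mult_left_mono power_mono abs_sin_x_le_abs_x) auto
    also have "\<dots> = t\<^sup>2 / 2 * (1 / (fact (Suc k))\<^sup>2)"
      by (simp add: x_def power_divide del: fact_Suc)
    also have "\<dots> \<le> t\<^sup>2 / 2 * (1 / fact k)"
    proof (intro mult_left_mono divide_left_mono)
      have "(fact k :: real) \<le> fact (Suc k)"
        by (intro fact_mono) auto
      also have "\<dots> \<le> (fact (Suc k))\<^sup>2"
        using fact_ge_1[of "Suc k", where 'a=real] by (intro self_le_power) auto
      finally show "(fact k :: real) \<le> (fact (Suc k))\<^sup>2" .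
    qed auto
    finally show ?thesis
      unfolding x_def .
  qed
  have "summable (\<lambda>k. t\<^sup>2 / 2 * (1 / fact k))"
    using summable_exp[of "1::real"] by (intro summable_mult) (simp add: inverse_eq_divide)
  then show "summable (\<lambda>k. norm (complex_of_real (cos (t / fact (Suc k))) - 1))"
    by (rule summable_comparison_test'[where N=0]) (use bound in simp)
qed

lemma weak_conv_scaled_bernoulli_upto:
  "\<exists>F. distribution_function F \<and> weak_conv (df_convolution_upto scaled_bernoulli_df) F"
proof -
  let ?G = "df_convolution_upto scaled_bernoulli_df"
  define \<mu> where "\<mu> n = interval_measure (?G n)" for n
  have rd: "real_distribution (\<mu> n)" for n
    by (simp add: \<mu>_def real_distribution_interval_measure_df scaled_bernoulli_upto_facts)
  have bound: "(\<Sum>k=1..n. 1 / fact k) \<le> exp (1 :: real)" for n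
  proof -
    have "(\<Sum>k=1..n. 1 / fact k) \<le> (\<Sum>k. inverse (fact k) * 1 ^ k :: real)"
      using sum_le_suminf[OF summable_exp[of "1::real"], of "{1..n}"]
      by (simp add: divide_inverse)
    then show ?thesis
      by (simp add: exp_def)
  qed
  have one: "measure (\<mu> n) {-4<..4} = 1" for n
  proof -
    interpret real_distribution "\<mu> n" by (rule rd)
    have "AE x in \<mu> n. x \<in> {-4<..4}"
      using scaled_bernoulli_upto_bound[of n] unfolding \<mu>_def[symmetric]
      by eventually_elim (use bound[of n] exp_le in auto)
    then show ?thesis
      by (subst prob_eq_1) auto
  qed
  have tight: "tight \<mu>"
    unfolding tight_def
  proof (intro conjI allI impI)
    fix \<epsilon> :: real assume "0 < \<epsilon>"
    then show "\<exists>a b. a < b \<and> (\<forall>n. measure (\<mu> n) {a<..b} > 1 - \<epsilon>)"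
      by (intro exI[of _ "-4"] exI[of _ 4]) (simp add: one)
  qed (rule rd)
  obtain r M where r: "strict_mono (r :: nat \<Rightarrow> nat)" and M: "real_distribution M"
    and wc: "weak_conv_m (\<mu> \<circ> id \<circ> r) M"
    using tight_imp_convergent_subsubsequence[OF tight strict_mono_id] by blast
  have ch: "(\<lambda>n. char (\<mu> n) t) \<longlonglongrightarrow> char M t" for t
  proof -
    have *: "char (\<mu> n) t = (\<Prod>k<n. complex_of_real (cos (t / fact (Suc k))))" for n
      by (simp add: \<mu>_def scaled_bernoulli_upto_facts prod.atLeast1_atMost_eq del: fact_Suc)
    obtain L where L: "(\<lambda>n. char (\<mu> n) t) \<longlonglongrightarrow> L"
      using convergent_prod_LIMSEQ[OF cos_product_convergent[of t]]
      unfolding * LIMSEQ_lessThan_iff_atMost by blast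
    have "(\<lambda>n. char ((\<mu> \<circ> id \<circ> r) n) t) \<longlonglongrightarrow> char M t"
      by (rule levy_continuity1[OF _ M wc]) (simp add: rd)
    moreover have "(\<lambda>n. char ((\<mu> \<circ> id \<circ> r) n) t) \<longlonglongrightarrow> L"
      using LIMSEQ_subseq_LIMSEQ[OF L r] by (simp add: comp_def)
    ultimately show ?thesis
      using L LIMSEQ_unique by metis
  qed
  have "weak_conv_m \<mu> M"
    by (rule levy_continuity[OF rd M ch])
  then have "weak_conv ?G (cdf M)"
    by (simp add: weak_conv_m_def \<mu>_def cdf_interval_measure_df scaled_bernoulli_upto_facts)
  then show ?thesis
    using distribution_function_cdf[OF M] by blast
qed

lemma F_s_facts:
  shows distribution_function_F_s: "distribution_function F_s"
    and weak_conv_F_s: "weak_conv (df_convolution_upto scaled_bernoulli_df) F_s"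
proof -
  let ?P = "\<lambda>F. distribution_function F \<and> weak_conv (df_convolution_upto scaled_bernoulli_df) F"
  obtain F where F: "?P F"
    using weak_conv_scaled_bernoulli_upto by blast
  have "\<exists>!F. ?P F"
  proof (rule ex1I[of ?P, OF F])
    fix G assume "?P G"
    then show "G = F"
      using F distribution_function_weak_limit_unique[of "df_convolution_upto scaled_bernoulli_df" G F]
        scaled_bernoulli_upto_facts(1) by blast
  qed
  from theI'[OF this] show "distribution_function F_s"
    "weak_conv (df_convolution_upto scaled_bernoulli_df) F_s"
    by (simp_all add: F_s_def infinite_df_convolution_def)
qed

lemma char_F_s:
  "(\<lambda>k. complex_of_real (cos (t / fact (Suc k)))) has_prod char (interval_measure F_s) t"
proof (rule convergent_prod_tendsto_imp_has_prod[OF cos_product_convergent])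
  let ?\<mu> = "\<lambda>n. interval_measure (df_convolution_upto scaled_bernoulli_df n)"
  have "weak_conv_m ?\<mu> (interval_measure F_s)"
    using F_s_facts by (simp add: weak_conv_m_def cdf_interval_measure_df scaled_bernoulli_upto_facts)
  then have "(\<lambda>n. char (?\<mu> n) t) \<longlonglongrightarrow> char (interval_measure F_s) t"
    by (intro levy_continuity1)
       (simp_all add: real_distribution_interval_measure_df scaled_bernoulli_upto_facts F_s_facts)
  then have "(\<lambda>n. \<Prod>k<n. complex_of_real (cos (t / fact (Suc k))))
      \<longlonglongrightarrow> char (interval_measure F_s) t"
    by (simp add: scaled_bernoulli_upto_facts prod.atLeast1_atMost_eq del: fact_Suc)
  then show "(\<lambda>n. \<Prod>k\<le>n. complex_of_real (cos (t / fact (Suc k))))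
      \<longlonglongrightarrow> char (interval_measure F_s) t"
    using LIMSEQ_lessThan_iff_atMost[of "\<lambda>A. \<Prod>k\<in>A. complex_of_real (cos (t / fact (Suc k)))"]
    by (simp del: fact_Suc)
qed

lemma F_s_unique:
  assumes "distribution_function F"
    and "\<And>t. (\<lambda>k. complex_of_real (cos (t / fact (Suc k)))) has_prod char (interval_measure F) t"
  shows "F = F_s"
proof -
  have "char (interval_measure F) = char (interval_measure F_s)"
    by (rule ext, rule has_prod_unique2[OF assms(2) char_F_s])
  then have "interval_measure F = interval_measure F_s"
    using assms(1) F_s_facts by (intro Levy_uniqueness real_distribution_interval_measure_df)
  then show ?thesis
    using assms(1) F_s_facts cdf_interval_measure_df by metis
qed

lemma distribution_function_F_star: "distribution_function F_star"
proof -
  have eq: "F_star = (\<lambda>x. 1/2 * degenerate_df 0 x + 1/2 * F_s x)"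
    by (simp add: fun_eq_iff F_star_def)
  have D: "distribution_function (degenerate_df 0)"
    by (rule degenerate_df_facts)
  note facts = D[unfolded distribution_function_def] F_s_facts(1)[unfolded distribution_function_def]
  have "mono F_star"
    using facts unfolding eq by (intro monoI add_mono mult_left_mono) (auto dest: monoD)
  moreover have "continuous (at_right a) F_star" for a
    using facts unfolding eq by (intro continuous_intros) auto
  moreover have "(F_star \<longlongrightarrow> 1/2 * 0 + 1/2 * 0) at_bot"
    using facts unfolding eq by (intro tendsto_intros) auto
  moreover have "(F_star \<longlongrightarrow> 1/2 * 1 + 1/2 * 1) at_top"
    using facts unfolding eq by (intro tendsto_intros) auto
  ultimately show ?thesis
    by (simp add: distribution_function_def)
qed

end

theory Submission
  imports Defs "HOL-Real_Asymp.Real_Asymp"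
begin

text \<open>
  Write \<open>f\<close> for a characteristic function. The obstruction to membership in the class \<open>Q\<close> is a
  regularity property of \<open>q(t) = ln \<bar>f(t)\<bar>\<^sup>2\<close>: for every fixed step \<open>h\<close>, the second difference
  \<open>q(t + h) + q(t - h) - 2 q(t)\<close> is bounded uniformly in \<open>t\<close>.

  For an infinitely divisible law this comes from the representation
  \<open>\<bar>f\<bar>\<^sup>2 = c\<^sub>n ^ n\<close>, where \<open>c\<^sub>n\<close> is the squared modulus of the characteristic function of an
  \<open>n\<close>-th convolution root and hence a cosine transform \<open>c\<^sub>n(t) = \<integral>cos(tx) d\<nu>\<^sub>n(x)\<close> of a probability
  law. From \<open>cos((t+h)x) + cos((t-h)x) - 2 cos(tx) = -2 cos(tx) (1 - cos(hx))\<close> the second difference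
  of \<open>c\<^sub>n\<close> is at most \<open>2 (1 - c\<^sub>n(h))\<close> in absolute value. Multiplying by \<open>n\<close> and letting \<open>n\<close> tend
  to infinity turns \<open>n (1 - c\<^sub>n)\<close> into \<open>-q\<close> and gives
  \<open>\<bar>q(t + h) + q(t - h) - 2 q(t)\<bar> \<le> -2 q(h)\<close>
  (\<open>infinitely_divisible_log_char_second_difference\<close>). If
  \<open>F\<^sub>1 = F * F\<^sub>2\<close> with \<open>F\<^sub>1\<close>, \<open>F\<^sub>2\<close> infinitely divisible, then the \<open>q\<close> of \<open>F\<close> is a difference of two
  such functions, so a uniform bound persists
  (\<open>rational_infinitely_divisible_log_char_second_difference\<close>).

  The law \<open>F_star\<close>, with characteristic function \<open>(1 + f\<^sub>s) / 2\<close>, violates the bound. For even \<open>N\<close>,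
  translation by \<open>\<pi> N!\<close> changes the argument of \<open>cos(t / k!)\<close> by a multiple of \<open>2\<pi>\<close> when \<open>k < N\<close>, by
  \<open>\<pi>\<close> when \<open>k = N\<close>, and by little when \<open>k > N\<close>. Hence \<open>f\<^sub>s(\<pi> N! + s)\<close> tends to \<open>-f\<^sub>s(s)\<close> for every
  \<open>s\<close> (\<open>cos_infinite_product_almost_antiperiod\<close>). Along these points the characteristic function
  of \<open>F_star\<close> tends to \<open>(1 - f\<^sub>s(0)) / 2 = 0\<close>, while at distance \<open>\<pi>\<close> from them it tends to
  \<open>(1 - f\<^sub>s(\<pi>)) / 2 = 1/2\<close>, because of the factor \<open>cos(\<pi> / 2!) = 0\<close>. So the second difference of
  \<open>q\<close> with step \<open>\<pi>\<close> is unbounded.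
\<close>

section \<open>Symmetrised laws\<close>

definition char_modulus_squared :: "(real \<Rightarrow> real) \<Rightarrow> real \<Rightarrow> real" where
  "char_modulus_squared F t = (cmod (char (interval_measure F) t))\<^sup>2"

lemma char_modulus_squared_nonneg: "0 \<le> char_modulus_squared F t"
  by (simp add: char_modulus_squared_def)

lemma char_modulus_squared_zero:
  assumes "distribution_function F"
  shows "char_modulus_squared F 0 = 1"
proof -
  interpret real_distribution "interval_measure F"
    by (rule real_distribution_interval_measure_df[OF assms])
  show ?thesis
    by (simp add: char_modulus_squared_def char_zero)
qed

lemma isCont_char_modulus_squared:
  assumes "distribution_function F"
  shows "isCont (char_modulus_squared F) t"
proof -
  interpret real_distribution "interval_measure F"
    by (rule real_distribution_interval_measure_df[OF assms])
  show ?thesis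
    unfolding char_modulus_squared_def by (intro continuous_intros isCont_char)
qed

lemma char_distr_uminus:
  assumes "real_distribution M"
  shows "char (distr M borel uminus) t = cnj (char M t)"
proof -
  interpret real_distribution M by fact
  have "char (distr M borel uminus) t = (\<integral>x. cnj (iexp (t * x)) \<partial>M)"
    unfolding char_def by (subst integral_distr) (auto simp: exp_cnj)
  then show ?thesis
    by (simp add: char_def)
qed

text \<open>Convolving a law with its reflection yields the law of the difference of two independent
  copies, whose characteristic function is \<open>\<bar>f\<bar>\<^sup>2\<close>. That function is real, so its exponential
  integral reduces to a cosine integral.\<close>

lemma char_modulus_squared_cosine_transform:
  assumes "distribution_function F"
  obtains N where "real_distribution N"
    and "\<And>t. char_modulus_squared F t = (\<integral>x. cos (t * x) \<partial>N)"
proof -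
  define M where "M = interval_measure F"
  have M: "real_distribution M"
    by (simp add: M_def assms real_distribution_interval_measure_df)
  interpret M: real_distribution M by fact
  have M': "real_distribution (distr M borel uminus)"
    by (rule M.real_distribution_distr) simp
  define N where "N = convolution M (distr M borel uminus)"
  have N: "real_distribution N"
    unfolding N_def by (rule real_distribution_convolution[OF M M'])
  interpret N: real_distribution N by fact
  have "char_modulus_squared F t = (\<integral>x. cos (t * x) \<partial>N)" for t
  proof -
    have int: "integrable N (\<lambda>x. iexp (t * x))"
      by (rule N.integrable_const_bound[where B=1]) auto
    have "complex_of_real (char_modulus_squared F t) = char N t"
      unfolding N_def char_convolution[OF M M'] char_distr_uminus[OF M]
      using complex_norm_square[of "char M t"] by (simp add: char_modulus_squared_def M_def)
    then have "char_modulus_squared F t = Re (char N t)"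
      by (metis Re_complex_of_real)
    also have "\<dots> = (\<integral>x. Re (iexp (t * x)) \<partial>N)"
      unfolding char_def by (rule integral_Re[OF int, symmetric])
    finally show ?thesis
      by (simp add: Re_exp)
  qed
  with N show ?thesis
    by (rule that)
qed

text \<open>The integrand of the second difference is \<open>-2 cos(tx) (1 - cos(hx))\<close>. Estimating
  \<open>\<bar>cos(tx)\<bar>\<close> by \<open>1\<close> leaves an integral in which \<open>t\<close> no longer occurs; this is the source of all the
  uniformity in \<open>t\<close> below.\<close>

lemma char_modulus_squared_second_difference:
  assumes "distribution_function F"
  shows "\<bar>char_modulus_squared F (t + h) + char_modulus_squared F (t - h)
            - 2 * char_modulus_squared F t\<bar> \<le> 2 * (1 - char_modulus_squared F h)"
proof -
  obtain N where N: "real_distribution N"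
    and eq: "\<And>t. char_modulus_squared F t = (\<integral>x. cos (t * x) \<partial>N)"
    using char_modulus_squared_cosine_transform[OF assms] by blast
  interpret real_distribution N by fact
  have int: "integrable N (\<lambda>x. cos (s * x))" for s
    by (rule integrable_const_bound[where B=1]) auto
  have prod: "cos ((t + h) * x) + cos ((t - h) * x) - 2 * cos (t * x)
      = - 2 * cos (t * x) * (1 - cos (h * x))" for x
    by (simp add: distrib_right left_diff_distrib cos_add cos_diff algebra_simps)
  have "\<bar>char_modulus_squared F (t + h) + char_modulus_squared F (t - h)
            - 2 * char_modulus_squared F t\<bar>
      = \<bar>\<integral>x. cos ((t + h) * x) + cos ((t - h) * x) - 2 * cos (t * x) \<partial>N\<bar>"
    by (simp add: eq int)
  also have "\<dots> \<le> (\<integral>x. \<bar>cos ((t + h) * x) + cos ((t - h) * x) - 2 * cos (t * x)\<bar> \<partial>N)"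
    by (rule integral_abs_bound)
  also have "\<dots> \<le> (\<integral>x. 2 * (1 - cos (h * x)) \<partial>N)"
  proof (rule integral_mono)
    fix x
    have "\<bar>cos (t * x)\<bar> * \<bar>1 - cos (h * x)\<bar> \<le> 1 * (1 - cos (h * x))"
      by (intro mult_mono) auto
    then show "\<bar>cos ((t + h) * x) + cos ((t - h) * x) - 2 * cos (t * x)\<bar> \<le> 2 * (1 - cos (h * x))"
      unfolding prod by (simp add: abs_mult)
  qed (auto intro!: int integrable_abs integrable_diff integrable_add integrable_mult_right)
  also have "\<dots> = 2 * (1 - char_modulus_squared F h)"
    using prob_space by (simp add: eq int)
  finally show ?thesis .
qed

lemma char_modulus_squared_doubling:
  assumes "distribution_function F"
  shows "1 - char_modulus_squared F (2 * t) \<le> 4 * (1 - char_modulus_squared F t)"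
  using char_modulus_squared_second_difference[OF assms, of t t]
  unfolding mult_2[of t] diff_self char_modulus_squared_zero[OF assms] right_diff_distrib
  by linarith

text \<open>If \<open>\<bar>f\<bar>\<^sup>2\<close> is close to \<open>1\<close> at \<open>t / 2\<^sup>k\<close>, then it cannot vanish at \<open>t\<close>. The constant depends on
  \<open>k\<close> only, so the estimate applies to all convolution roots of a law at once.\<close>

lemma char_modulus_squared_doubling_power:
  assumes "distribution_function F"
  shows "1 - char_modulus_squared F t \<le> 4 ^ k * (1 - char_modulus_squared F (t / 2 ^ k))"
proof (induction k)
  case (Suc k)
  have "1 - char_modulus_squared F (t / 2 ^ k)
      \<le> 4 * (1 - char_modulus_squared F (t / 2 ^ Suc k))"
    using char_modulus_squared_doubling[OF assms, of "t / 2 ^ Suc k"] by simp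
  then have "4 ^ k * (1 - char_modulus_squared F (t / 2 ^ k))
      \<le> 4 ^ Suc k * (1 - char_modulus_squared F (t / 2 ^ Suc k))"
    by (simp add: mult.assoc mult.left_commute)
  with Suc.IH show ?case
    by linarith
qed simp

section \<open>Infinitely divisible laws\<close>

lemma df_convolution_power_facts:
  assumes "distribution_function G"
  shows "distribution_function (df_convolution_power G n)" (is ?A)
    and "char_modulus_squared (df_convolution_power G n) t = char_modulus_squared G t ^ n" (is ?B)
proof -
  have "?A \<and> char (interval_measure (df_convolution_power G n)) t
      = char (interval_measure G) t ^ n"
  proof (induction n)
    case 0
    show ?case
      using degenerate_df_facts[of 0] by (simp add: char_def integral_return)
  next
    case (Suc n)
    then show ?case
      using assms by (simp add: df_convolution_interval_measure char_convolution
          real_distribution_interval_measure_df)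
  qed
  then show ?A ?B
    by (simp_all add: char_modulus_squared_def norm_power power_mult mult.commute flip: power_mult)
qed

text \<open>The roots are indexed so that \<open>G n\<close> is a root of order \<open>n + 1\<close>, which avoids a side condition
  on \<open>n\<close>.\<close>

lemma infinitely_divisible_roots:
  assumes "infinitely_divisible F"
  obtains G where "\<And>n. distribution_function (G n)"
    and "\<And>n t. char_modulus_squared F t = char_modulus_squared (G n) t ^ Suc n"
proof -
  have "\<exists>G. distribution_function G \<and> df_convolution_power G (Suc n) = F" for n
    using assms unfolding infinitely_divisible_def by blast
  then obtain G where "\<And>n. distribution_function (G n)"
    "\<And>n. df_convolution_power (G n) (Suc n) = F"
    by metis
  then show ?thesis
    using that df_convolution_power_facts(2) by metis
qed

lemma tendsto_root_and_log:
  fixes c :: "nat \<Rightarrow> real"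
  assumes p: "0 < p" and c: "\<And>n. 0 \<le> c n" "\<And>n. p = c n ^ Suc n"
  shows "c \<longlonglongrightarrow> 1" and "(\<lambda>n. Suc n * (1 - c n)) \<longlonglongrightarrow> - ln p"
proof -
  have "c n = p powr (1 / Suc n)" for n
  proof -
    have "0 < c n"
      using c[of n] p by (metis less_eq_real_def power_0_Suc)
    then show ?thesis
      unfolding c(2)[of n]
      by (simp add: powr_powr del: power_Suc of_nat_Suc flip: powr_realpow)
  qed
  then have *: "c = (\<lambda>n. p powr (1 / Suc n))" ..
  show "c \<longlonglongrightarrow> 1"
    unfolding * using p by real_asymp
  show "(\<lambda>n. Suc n * (1 - c n)) \<longlonglongrightarrow> - ln p"
    unfolding * using p by real_asymp
qed

text \<open>At a zero \<open>t\<close> of \<open>f\<close> the characteristic functions of all convolution roots vanish as well. By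
  continuity \<open>f\<close> is nonzero at some \<open>t / 2\<^sup>k\<close>, and there the roots of \<open>\<bar>f\<bar>\<^sup>2\<close> tend to \<open>1\<close>. The doubling
  estimate, with its constant \<open>4\<^sup>k\<close>, rules this out.\<close>

lemma infinitely_divisible_char_nonzero:
  assumes "infinitely_divisible F"
  shows "0 < char_modulus_squared F t"
proof (rule ccontr)
  assume "\<not> ?thesis"
  then have zero: "char_modulus_squared F t = 0"
    using char_modulus_squared_nonneg[of F t] by simp
  have F: "distribution_function F"
    using assms by (simp add: infinitely_divisible_def)
  obtain G where G: "\<And>n. distribution_function (G n)"
    "\<And>n t. char_modulus_squared F t = char_modulus_squared (G n) t ^ Suc n"
    using infinitely_divisible_roots[OF assms] by blast
  have "(\<lambda>k. t / 2 ^ k) \<longlonglongrightarrow> 0"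
    by real_asymp
  then have "(\<lambda>k. char_modulus_squared F (t / 2 ^ k)) \<longlonglongrightarrow> 1"
    using isCont_tendsto_compose[OF isCont_char_modulus_squared[OF F]]
      char_modulus_squared_zero[OF F] by metis
  then have "\<forall>\<^sub>F k in sequentially. 0 < char_modulus_squared F (t / 2 ^ k)"
    by (rule order_tendstoD) simp
  then obtain k where k: "0 < char_modulus_squared F (t / 2 ^ k)"
    by (auto simp: eventually_sequentially)
  have "char_modulus_squared (G n) t = 0" for n
    using zero G(2)[of t n] by (simp del: power_Suc)
  then have "1 \<le> 4 ^ k * (1 - char_modulus_squared (G n) (t / 2 ^ k))" for n
    using char_modulus_squared_doubling_power[OF G(1), of n t k] by simp
  moreover have "(\<lambda>n. 4 ^ k * (1 - char_modulus_squared (G n) (t / 2 ^ k))) \<longlonglongrightarrow> 4 ^ k * (1 - 1)"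
    by (intro tendsto_intros tendsto_root_and_log(1)[OF k])
       (use G(2) char_modulus_squared_nonneg in auto)
  ultimately have "1 \<le> (4 ^ k * (1 - 1) :: real)"
    using LIMSEQ_le_const by blast
  then show False
    by simp
qed

text \<open>The second-difference bound holds for the convolution roots, and it is homogeneous: scaled by
  the order \<open>n + 1\<close> of the root it survives the limit
  \<open>(n + 1) (1 - c\<^sub>n) \<longlonglongrightarrow> - ln \<bar>f\<bar>\<^sup>2\<close>.\<close>

lemma infinitely_divisible_log_char_second_difference:
  assumes "infinitely_divisible F"
  defines "q \<equiv> \<lambda>t. ln (char_modulus_squared F t)"
  shows "\<bar>q (t + h) + q (t - h) - 2 * q t\<bar> \<le> - 2 * q h"
proof -
  obtain G where G: "\<And>n. distribution_function (G n)"
    "\<And>n t. char_modulus_squared F t = char_modulus_squared (G n) t ^ Suc n"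
    using infinitely_divisible_roots[OF assms(1)] by blast
  define d where "d n s = Suc n * (1 - char_modulus_squared (G n) s)" for n s
  have lim: "(\<lambda>n. d n s) \<longlonglongrightarrow> - q s" for s
    unfolding d_def q_def using G(2) char_modulus_squared_nonneg
    by (intro tendsto_root_and_log(2) infinitely_divisible_char_nonzero[OF assms(1)]) auto
  have "\<bar>d n (t + h) + d n (t - h) - 2 * d n t\<bar> \<le> 2 * d n h" for n
  proof -
    let ?c = "char_modulus_squared (G n)"
    have "d n (t + h) + d n (t - h) - 2 * d n t = - (Suc n * (?c (t + h) + ?c (t - h) - 2 * ?c t))"
      by (simp add: d_def algebra_simps)
    also have "\<bar>\<dots>\<bar> = Suc n * \<bar>?c (t + h) + ?c (t - h) - 2 * ?c t\<bar>"
      by (simp only: abs_minus_cancel abs_mult abs_of_nat)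
    also have "\<dots> \<le> Suc n * (2 * (1 - ?c h))"
      by (intro mult_left_mono char_modulus_squared_second_difference G) simp
    also have "\<dots> = 2 * d n h"
      by (simp add: d_def)
    finally show ?thesis .
  qed
  moreover have "(\<lambda>n. \<bar>d n (t + h) + d n (t - h) - 2 * d n t\<bar>)
      \<longlonglongrightarrow> \<bar>- q (t + h) + - q (t - h) - 2 * - q t\<bar>"
    by (intro tendsto_intros lim)
  moreover have "(\<lambda>n. 2 * d n h) \<longlonglongrightarrow> 2 * - q h"
    by (intro tendsto_intros lim)
  ultimately have "\<bar>- q (t + h) + - q (t - h) - 2 * - q t\<bar> \<le> 2 * - q h"
    by (intro LIMSEQ_le[where X="\<lambda>n. \<bar>d n (t + h) + d n (t - h) - 2 * d n t\<bar>"]) auto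
  then show ?thesis
    by linarith
qed

text \<open>From \<open>F\<^sub>1 = F * F\<^sub>2\<close> one gets \<open>\<bar>f\<^sub>1\<bar>\<^sup>2 = \<bar>f\<bar>\<^sup>2 \<bar>f\<^sub>2\<bar>\<^sup>2\<close>. The left side has no zeros, so neither does
  \<open>f\<close>, and \<open>ln \<bar>f\<bar>\<^sup>2\<close> is a difference of two functions with bounded second differences.\<close>

lemma rational_infinitely_divisible_log_char_second_difference:
  assumes "F \<in> rational_infinitely_divisible"
  defines "q \<equiv> \<lambda>t. ln (char_modulus_squared F t)"
  shows "0 < char_modulus_squared F t"
    and "\<exists>C. \<forall>t. \<bar>q (t + h) + q (t - h) - 2 * q t\<bar> \<le> C"
proof -
  obtain F1 F2 where F: "distribution_function F"
    and id: "infinitely_divisible F1" "infinitely_divisible F2" and F1: "F1 = df_convolution F F2"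
    using assms(1) by (auto simp: rational_infinitely_divisible_def)
  have F2: "distribution_function F2"
    using id by (simp add: infinitely_divisible_def)
  have mult: "char_modulus_squared F1 t = char_modulus_squared F t * char_modulus_squared F2 t" for t
    unfolding F1 char_modulus_squared_def df_convolution_interval_measure(2)[OF F F2]
    by (simp add: char_convolution real_distribution_interval_measure_df F F2 norm_mult
        power_mult_distrib)
  show pos: "0 < char_modulus_squared F t" for t
    using mult[of t] infinitely_divisible_char_nonzero[OF id(1), of t]
      infinitely_divisible_char_nonzero[OF id(2), of t]
    by (simp add: zero_less_mult_iff)
  define q1 where "q1 t = ln (char_modulus_squared F1 t)" for t
  define q2 where "q2 t = ln (char_modulus_squared F2 t)" for t
  have q: "q t = q1 t - q2 t" for t
    unfolding q_def q1_def q2_def mult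
    using pos infinitely_divisible_char_nonzero[OF id(2)] by (simp add: ln_mult_pos)
  have "\<bar>q (t + h) + q (t - h) - 2 * q t\<bar> \<le> - 2 * q1 h + - 2 * q2 h" for t
    using infinitely_divisible_log_char_second_difference[OF id(1), of t h]
      infinitely_divisible_log_char_second_difference[OF id(2), of t h]
    unfolding q q1_def[symmetric] q2_def[symmetric] right_diff_distrib by linarith
  then show "\<exists>C. \<forall>t. \<bar>q (t + h) + q (t - h) - 2 * q t\<bar> \<le> C"
    by blast
qed

section \<open>Almost antiperiods of the infinite cosine product\<close>

definition cos_partial_product :: "nat \<Rightarrow> real \<Rightarrow> real" where
  "cos_partial_product n t = (\<Prod>k=1..n. cos (t / fact k))"

definition cos_infinite_product :: "real \<Rightarrow> real" where
  "cos_infinite_product t = Re (char (interval_measure F_s) t)"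

lemma cos_infinite_product_facts:
  shows char_F_s_real: "char (interval_measure F_s) t = cos_infinite_product t"
    and cos_partial_product_tendsto:
      "(\<lambda>n. cos_partial_product n t) \<longlonglongrightarrow> cos_infinite_product t"
proof -
  have "(\<lambda>n. \<Prod>k\<in>{..n}. complex_of_real (cos (t / fact (Suc k))))
      \<longlonglongrightarrow> char (interval_measure F_s) t"
    by (rule has_prod_imp_tendsto[OF char_F_s])
  then have lim: "(\<lambda>n. complex_of_real (cos_partial_product n t))
      \<longlonglongrightarrow> char (interval_measure F_s) t"
    unfolding LIMSEQ_lessThan_iff_atMost[symmetric]
    by (simp add: cos_partial_product_def prod.atLeast1_atMost_eq del: fact_Suc)
  from tendsto_Re[OF this] show "(\<lambda>n. cos_partial_product n t) \<longlonglongrightarrow> cos_infinite_product t"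
    by (simp add: cos_infinite_product_def)
  from tendsto_of_real[OF this, where 'a=complex] lim
  show "char (interval_measure F_s) t = cos_infinite_product t"
    using LIMSEQ_unique by blast
qed

lemma abs_cos_partial_product_le_1: "\<bar>cos_partial_product n t\<bar> \<le> 1"
  unfolding cos_partial_product_def abs_prod by (intro prod_le_1) auto

text \<open>Since all factors have modulus at most \<open>1\<close>, appending the factor \<open>cos x\<close> with
  \<open>x = u / (M + 1)!\<close> changes the product by at most \<open>\<bar>cos x - 1\<bar> \<le> x\<^sup>2 / 2\<close>. For \<open>\<bar>u\<bar> \<le> C N!\<close> and
  \<open>M \<ge> N\<close> one has \<open>\<bar>x\<bar> \<le> C / (M + 1)\<close>, and the estimate \<open>1 / (M + 1)\<^sup>2 \<le> 1 / M - 1 / (M + 1)\<close> makes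
  the sum of these changes telescope. What matters is that the bound tends to \<open>0\<close> for large \<open>N\<close>
  although \<open>u\<close> may grow like \<open>N!\<close>.\<close>

lemma cos_partial_product_diff_le:
  assumes "0 < N" "N \<le> M" and u: "\<bar>u\<bar> \<le> C * fact N"
  shows "\<bar>cos_partial_product M u - cos_partial_product N u\<bar> \<le> C\<^sup>2 / 2 * (1 / N - 1 / M)"
  using assms(2)
proof (induction M rule: dec_induct)
  case base
  show ?case by simp
next
  case (step M)
  define x where "x = u / fact (Suc M)"
  have "0 \<le> C"
    using u by (metis abs_ge_zero fact_gt_zero order_trans zero_le_mult_iff not_le)
  have "\<bar>u\<bar> \<le> C * fact M"
    using u mult_left_mono[OF fact_mono[OF step.hyps(1)] \<open>0 \<le> C\<close>] by linarith
  then have "\<bar>x\<bar> \<le> C / Suc M"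
    by (simp add: x_def abs_divide divide_simps abs_mult)
  then have x2: "x\<^sup>2 \<le> (C / Suc M)\<^sup>2"
    by (metis abs_ge_zero power2_abs power_mono)
  have "\<bar>cos x - 1\<bar> = 2 * \<bar>sin (x / 2)\<bar>\<^sup>2"
    using cos_double_sin[of "x / 2"] by simp
  also have "\<dots> \<le> 2 * \<bar>x / 2\<bar>\<^sup>2"
    by (intro mult_left_mono power_mono abs_sin_x_le_abs_x) auto
  also have "\<dots> = x\<^sup>2 / 2"
    by (simp add: power_divide)
  also have "\<dots> \<le> (C / Suc M)\<^sup>2 / 2"
    using x2 by simp
  also have "\<dots> = C\<^sup>2 / 2 * (1 / (real (Suc M))\<^sup>2)"
    by (simp add: power_divide)
  also have "\<dots> \<le> C\<^sup>2 / 2 * (1 / M - 1 / Suc M)"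
  proof (intro mult_left_mono)
    have "0 < M"
      using assms(1) step.hyps by linarith
    then show "1 / (real (Suc M))\<^sup>2 \<le> 1 / M - 1 / Suc M"
      by (simp add: divide_simps power2_eq_square)
  qed simp
  finally have cos_le: "\<bar>cos x - 1\<bar> \<le> C\<^sup>2 / 2 * (1 / M - 1 / Suc M)" .
  have "cos_partial_product (Suc M) u - cos_partial_product M u
      = cos_partial_product M u * (cos x - 1)"
    by (simp add: cos_partial_product_def x_def algebra_simps del: fact_Suc)
  then have "\<bar>cos_partial_product (Suc M) u - cos_partial_product M u\<bar> \<le> \<bar>cos x - 1\<bar>"
    using abs_cos_partial_product_le_1[of M u] by (simp add: abs_mult mult_left_le_one_le)
  with cos_le step.IH show ?case
    unfolding right_diff_distrib by linarith
qed

lemma cos_infinite_product_approx: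
  assumes "0 < N" "\<bar>u\<bar> \<le> C * fact N"
  shows "\<bar>cos_infinite_product u - cos_partial_product N u\<bar> \<le> C\<^sup>2 / 2 / N"
proof (rule LIMSEQ_le_const2)
  show "(\<lambda>M. \<bar>cos_partial_product M u - cos_partial_product N u\<bar>)
      \<longlonglongrightarrow> \<bar>cos_infinite_product u - cos_partial_product N u\<bar>"
    by (intro tendsto_intros cos_partial_product_tendsto)
  have "\<bar>cos_partial_product M u - cos_partial_product N u\<bar> \<le> C\<^sup>2 / 2 / N" if "N \<le> M" for M
  proof -
    have "C\<^sup>2 / 2 * (1 / N - 1 / M) \<le> C\<^sup>2 / 2 * (1 / N)"
      by (intro mult_left_mono) auto
    with cos_partial_product_diff_le[OF assms(1) that assms(2)] show ?thesis
      by simp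
  qed
  then show "\<exists>n. \<forall>M\<ge>n. \<bar>cos_partial_product M u - cos_partial_product N u\<bar> \<le> C\<^sup>2 / 2 / N"
    by blast
qed

text \<open>For \<open>k < N\<close> the quotient \<open>N! / k!\<close> is a multiple of \<open>N\<close> and hence even, so the shift by
  \<open>\<pi> N!\<close> is a period of \<open>cos(t / k!)\<close>. Only the last factor, \<open>k = N\<close>, changes its sign.\<close>

lemma cos_partial_product_antiperiod:
  assumes "even N" "0 < N"
  shows "cos_partial_product N (pi * fact N + s) = - cos_partial_product N s"
proof -
  obtain m where N: "N = Suc m"
    using assms(2) gr0_conv_Suc by auto
  have "cos ((pi * fact N + s) / fact k) = cos (s / fact k)" if "k \<in> {1..m}" for k
  proof -
    have "fact k dvd (fact m :: nat)"
      using that by (intro fact_dvd) simp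
    then obtain j where j: "fact m = fact k * (j :: nat)" ..
    obtain i where i: "N = 2 * i"
      using assms(1) by blast
    have "(fact N :: real) = real N * fact m"
      unfolding N by simp
    also have "\<dots> = fact k * (2 * real (i * j))"
      using arg_cong[OF j, of real] i by simp
    finally have "(pi * fact N + s) / fact k = s / fact k + 2 * real (i * j) * pi"
      by (simp add: field_simps)
    then show ?thesis
      by (simp only: cos_add cos_2npi sin_2npi mult_zero_right mult_1_right diff_zero)
  qed
  then have "cos_partial_product m (pi * fact N + s) = cos_partial_product m s"
    unfolding cos_partial_product_def by (intro prod.cong) auto
  moreover have "cos ((pi * fact N + s) / fact N) = - cos (s / fact N)"
    by (simp add: add_divide_distrib cos_add)
  ultimately show ?thesis
    by (simp add: cos_partial_product_def N del: fact_Suc)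
qed

text \<open>The points \<open>\<pi> (2n)! + s\<close> stay within \<open>(\<pi> + \<bar>s\<bar>) (2n)!\<close>, so at each of them the infinite
  product differs from its first \<open>2n\<close> factors by \<open>O(1/n)\<close>, and the antiperiod of the partial products
  passes to the limit.\<close>

lemma cos_infinite_product_almost_antiperiod:
  "(\<lambda>n. cos_infinite_product (pi * fact (2 * n) + s)) \<longlonglongrightarrow> - cos_infinite_product s"
proof -
  let ?P = "\<lambda>n. cos_partial_product (2 * n)"
  let ?u = "\<lambda>n. pi * fact (2 * n) + s"
  have even: "filterlim (\<lambda>n. 2 * n :: nat) sequentially sequentially"
    by (intro filterlim_subseq strict_monoI) simp
  have close: "\<bar>cos_infinite_product (?u n) + ?P n s\<bar> \<le> (pi + \<bar>s\<bar>)\<^sup>2 / 2 / real (2 * n)"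
    if "0 < n" for n
  proof -
    have "\<bar>s\<bar> * 1 \<le> \<bar>s\<bar> * fact (2 * n)"
      by (intro mult_left_mono fact_ge_1) simp
    moreover have "\<bar>?u n\<bar> \<le> pi * fact (2 * n) + \<bar>s\<bar>"
      by (rule order_trans[OF abs_triangle_ineq]) (simp add: abs_mult)
    ultimately have "\<bar>?u n\<bar> \<le> (pi + \<bar>s\<bar>) * fact (2 * n)"
      unfolding distrib_right by linarith
    from cos_infinite_product_approx[OF _ this] that show ?thesis
      using cos_partial_product_antiperiod[of "2 * n" s] by simp
  qed
  have "(\<lambda>n. cos_infinite_product (?u n) + ?P n s) \<longlonglongrightarrow> 0"
  proof (rule Lim_null_comparison)
    show "\<forall>\<^sub>F n in sequentially. norm (cos_infinite_product (?u n) + ?P n s)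
        \<le> (pi + \<bar>s\<bar>)\<^sup>2 / 2 / real (2 * n)"
      using eventually_gt_at_top[of 0] by eventually_elim (use close in simp)
    show "(\<lambda>n. (pi + \<bar>s\<bar>)\<^sup>2 / 2 / real (2 * n)) \<longlonglongrightarrow> 0"
      by real_asymp
  qed
  from tendsto_diff[OF this filterlim_compose[OF cos_partial_product_tendsto[of s] even]]
  show ?thesis
    by simp
qed

lemma cos_infinite_product_0: "cos_infinite_product 0 = 1"
proof -
  interpret real_distribution "interval_measure F_s"
    by (rule real_distribution_interval_measure_df[OF distribution_function_F_s])
  show ?thesis
    by (simp add: cos_infinite_product_def char_zero)
qed

lemma cos_infinite_product_pi:
  assumes "\<bar>s\<bar> = pi"
  shows "cos_infinite_product s = 0"
proof (rule LIMSEQ_unique[OF cos_partial_product_tendsto tendsto_eventually])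
  have "cos (s / fact 2) = 0"
    using assms abs_eq_iff[of s pi] by (auto simp: fact_numeral)
  then show "\<forall>\<^sub>F n in sequentially. cos_partial_product n s = 0"
    unfolding eventually_sequentially cos_partial_product_def
    by (intro exI[of _ 2] allI impI prod_zero bexI[of _ 2]) auto
qed

section \<open>The mixture with an atom at the origin\<close>

text \<open>The mixture is realised as the law of \<open>B X\<close>, where \<open>B\<close> is a fair \<open>{0, 1}\<close>-valued coin and \<open>X\<close> is
  an independent variable with distribution function \<open>F_s\<close>. Both the distribution function and the
  characteristic function are expectations of bounded functions, so one Fubini computation gives
  both.\<close>

lemma F_star_mixture_law:
  obtains M where "real_distribution M" "cdf M = F_star"
    "\<And>t. char M t = 1/2 + 1/2 * char (interval_measure F_s) t"
proof -
  define S where "S = interval_measure F_s"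
  have "real_distribution S"
    unfolding S_def by (rule real_distribution_interval_measure_df[OF distribution_function_F_s])
  then interpret S: real_distribution S .
  let ?B = "measure_pmf (bernoulli_pmf (1/2))"
  interpret pair_prob_space ?B S ..
  define X where "X = (\<lambda>(b, x). if b then x else 0 :: real)"
  have [measurable]: "X \<in> borel_measurable (?B \<Otimes>\<^sub>M S)"
    unfolding X_def by measurable
  define M where "M = distr (?B \<Otimes>\<^sub>M S) borel X"
  have M: "real_distribution M"
    unfolding M_def by (rule P.real_distribution_distr) measurable
  then interpret M: real_distribution M .
  have mix: "(\<integral>x. f x \<partial>M) = (1/2) *\<^sub>R f 0 + (1/2) *\<^sub>R (\<integral>x. f x \<partial>S)"
    if f[measurable]: "f \<in> borel_measurable borel" and bnd: "\<And>x. norm (f x) \<le> 1"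
    for f :: "real \<Rightarrow> 'b :: {banach, second_countable_topology}"
  proof -
    have int: "integrable (?B \<Otimes>\<^sub>M S) (\<lambda>(b, x). f (X (b, x)))"
      by (rule P.integrable_const_bound[where B=1]) (auto simp: bnd)
    have "(\<integral>x. f x \<partial>M) = (\<integral>z. (\<lambda>(b, x). f (X (b, x))) z \<partial>(?B \<Otimes>\<^sub>M S))"
      unfolding M_def by (subst integral_distr) (auto simp: case_prod_unfold)
    also have "\<dots> = (\<integral>b. (\<integral>x. f (X (b, x)) \<partial>S) \<partial>?B)"
      by (rule integral_fst[OF int, symmetric])
    also have "\<dots> = (1/2) *\<^sub>R f 0 + (1/2) *\<^sub>R (\<integral>x. f x \<partial>S)"
      using S.prob_space by (subst integral_measure_pmf[where A=UNIV]) (auto simp: UNIV_bool X_def)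
    finally show ?thesis .
  qed
  have "cdf M = F_star"
  proof
    fix x
    have "cdf M x = (\<integral>y. indicator {..x} y \<partial>M)"
      by (simp add: cdf_def2)
    also have "\<dots> = 1/2 * indicator {..x} 0 + 1/2 * cdf S x"
      by (subst mix) (auto simp: cdf_def2 indicator_def)
    finally show "cdf M x = F_star x"
      by (simp add: F_star_def degenerate_df_def S_def
          cdf_interval_measure_df[OF distribution_function_F_s])
  qed
  moreover have "char M t = 1/2 + 1/2 * char S t" for t
    unfolding char_def by (subst mix) (auto simp: scaleR_conv_of_real)
  ultimately show ?thesis
    using that M by (simp add: S_def)
qed

lemma char_modulus_squared_F_star:
  "char_modulus_squared F_star t = ((1 + cos_infinite_product t) / 2)\<^sup>2"
proof -
  obtain M where M: "real_distribution M" "cdf M = F_star"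
    "\<And>t. char M t = 1/2 + 1/2 * char (interval_measure F_s) t"
    using F_star_mixture_law by blast
  have "interval_measure F_star = M"
    using interval_measure_cdf[OF M(1)] M(2) by simp
  then have "char (interval_measure F_star) t = of_real ((1 + cos_infinite_product t) / 2)"
    by (simp add: M(3) char_F_s_real add_divide_distrib)
  then show ?thesis
    unfolding char_modulus_squared_def by (simp only: norm_of_real power2_abs)
qed

theorem proposition2:
  shows "F_star \<notin> rational_infinitely_divisible"
proof
  assume Q: "F_star \<in> rational_infinitely_divisible"
  define q where "q t = ln (char_modulus_squared F_star t)" for t
  obtain C where C: "\<And>t. \<bar>q (t + pi) + q (t - pi) - 2 * q t\<bar> \<le> C"
    using rational_infinitely_divisible_log_char_second_difference(2)[OF Q, of pi]
    unfolding q_def by blast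
  define \<tau> where "\<tau> n = pi * fact (2 * n)" for n :: nat
  have lim: "(\<lambda>n. char_modulus_squared F_star (\<tau> n + s))
      \<longlonglongrightarrow> ((1 + - cos_infinite_product s) / 2)\<^sup>2" for s
    unfolding char_modulus_squared_F_star \<tau>_def
    by (intro tendsto_intros cos_infinite_product_almost_antiperiod) simp
  have "(\<lambda>n. q (\<tau> n + s)) \<longlonglongrightarrow> ln (1/4)" if "\<bar>s\<bar> = pi" for s
    unfolding q_def using lim[of s] cos_infinite_product_pi[OF that]
    by (intro tendsto_ln) (simp_all add: power_divide)
  from tendsto_add[OF this[of pi] this[of "- pi"]]
  have sides: "(\<lambda>n. q (\<tau> n + pi) + q (\<tau> n - pi)) \<longlonglongrightarrow> ln (1/4) + ln (1/4)"
    by simp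
  have "filterlim (\<lambda>n. char_modulus_squared F_star (\<tau> n)) (at_right 0) sequentially"
    using lim[of 0] rational_infinitely_divisible_log_char_second_difference(1)[OF Q]
    by (intro tendsto_imp_filterlim_at_right) (simp_all add: cos_infinite_product_0)
  then have "filterlim (\<lambda>n. q (\<tau> n)) at_bot sequentially"
    unfolding q_def by (rule filterlim_compose[OF ln_at_0])
  \<comment> \<open>The threshold is chosen so that \<open>2 q(\<tau>\<^sub>n) + C < 2 ln(1/4) - 1\<close>, which lies below the limit of
    \<open>q(\<tau>\<^sub>n + \<pi>) + q(\<tau>\<^sub>n - \<pi>)\<close>.\<close>
  then have "\<forall>\<^sub>F n in sequentially. q (\<tau> n) < ln (1/4) - 1/2 - C/2"
    unfolding filterlim_at_bot_dense by blast
  moreover have "\<forall>\<^sub>F n in sequentially. ln (1/4) + ln (1/4) - 1 < q (\<tau> n + pi) + q (\<tau> n - pi)"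
    by (rule order_tendstoD(1)[OF sides]) simp
  ultimately have "\<forall>\<^sub>F n :: nat in sequentially. False"
  proof eventually_elim
    case (elim n)
    then show False
      using C[of "\<tau> n"] by linarith
  qed
  then show False
    by simp
qed

end
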